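(* Let $S\in\mathbb{R}^{m\times n}$ be such that $SA$ has full column rank, let $x_0\in\mathbb{R}^d$, and let $\xi_i=\langle v_i,\Delta_0\rangle$ for $i=1,\dots,d$. For $t\ge 0$ define $$\ell_t^*(S,x_0) := \min_{Q\in\mathbb{R}_t[X],\;Q(0)=1}\ \frac12\sum_{i=1}^d Q(\lambda_i^{-1})^2\,\xi_i^2 .$$ Then any preconditioned first-order method with the fixed embedding $S$ and starting at $x_0$ satisfies $\delta_t\ge \ell_t^*(S,x_0)$ for every $t\ge 0$. Furthermore, the preconditioned conjugate gradient method (PCG) with preconditioner $H_S$ starting at $x_0$ attains this lower bound, i.e. its iterates satisfy $\delta_t=\ell_t^*(S,x_0)$ for every $t\geq 0$.
   Context: Let $n\ge d$, let $A\in\mathbb{R}^{n\times d}$ have full column rank, $b\in\mathbb{R}^d$, $H=A^\top A$, $f(x)=\frac12\langle x,Hx\rangle-\langle b,x\rangle$, and $x^*=\mathrm{argmin}_x f(x)=H^{-1}b$. Let $A=U\Sigma V^\top$ be a thin SVD ($U\in\mathbb{R}^{n\times d}$ with orthonormal columns) and write $H^{1/2}:=U^\top A$, so that $H=(H^{1/2})^\top H^{1/2}$. For an iterate $x_t$, set $\Delta_t=H^{1/2}(x_t-x^* )$ and $\delta_t=\frac12\|\Delta_t\|_2^2=\frac12\langle x_t-x^*,H(x_t-x^* )\rangle$. For $S\in\mathbb{R}^{m\times n}$ set $H_S=A^\top S^\top S A$ (invertible here) and $C_S=U^\top S^\top S U$, with eigenvalue decomposition $C_S=\sum_{i=1}^d\lambda_i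 v_iv_i^\top$, $(v_i)$ orthonormal. $\mathbb{R}_t[X]$ denotes real polynomials of degree at most $t$. A preconditioned first-order method with fixed embedding $S$ starting at $x_0$ is any sequence $(x_t)$ with $x_{t+1}\in x_0+\mathrm{span}\{H_S^{-1}\nabla f(x_0),\dots,H_S^{-1}\nabla f(x_t)\}$ for all $t\ge0$. PCG: $r_0=b-Hx_0$, $\hat r_0=H_S^{-1}r_0$, $p_0=\hat r_0$, and for $t\ge 0$: $\alpha_t=\frac{r_t^\top\hat r_t}{p_t^\top Hp_t}$, $x_{t+1}=x_t+\alpha_tp_t$, $r_{t+1}=r_t-\alpha_tHp_t$, $\hat r_{t+1}=H_S^{-1}r_{t+1}$, $p_{t+1}=\hat r_{t+1}+\frac{r_{t+1}^\top\hat r_{t+1}}{r_t^\top\hat r_t}p_t$. If $r_t=0$ the method stops and $x_s:=x_t$ for $s\ge t$. *)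

theory Defs
  imports "HOL-Analysis.Analysis" "HOL-Computational_Algebra.Polynomial"
begin

section \<open>The least-squares problem\<close>

definition hess :: "real^'d^'n \<Rightarrow> real^'d^'d" where
  "hess A = transpose A ** A"

definition objective :: "real^'d^'n \<Rightarrow> real^'d \<Rightarrow> real^'d \<Rightarrow> real" where
  "objective A b x = 1/2 * (x \<bullet> (hess A *v x)) - b \<bullet> x"

text \<open>For injective \<open>A\<close> the minimizer exists and is unique, so the choice made by
  \<^const>\<open>arg_min\<close> is irrelevant; see \<open>minimizer_eq\<close> and \<open>minimizer_is_arg_min\<close> below.\<close>

definition minimizer :: "real^'d^'n \<Rightarrow> real^'d \<Rightarrow> real^'d" where
  "minimizer A b = arg_min (objective A b) (\<lambda>_. True)"

definition gradient :: "('a::real_inner \<Rightarrow> real) \<Rightarrow> 'a \<Rightarrow> 'a" where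
  "gradient f x = (THE D. GDERIV f x :> D)"

text \<open>The columns of \<open>U\<close> are orthonormal, \<open>V\<close> is orthogonal, \<open>Sig\<close> is diagonal with
  nonnegative entries. No ordering of the singular values is imposed, the index type
  being an arbitrary finite type.\<close>

definition thin_svd :: "real^'d^'n \<Rightarrow> real^'d^'n \<Rightarrow> real^'d^'d \<Rightarrow> real^'d^'d \<Rightarrow> bool" where
  "thin_svd A U Sig V \<longleftrightarrow>
     A = U ** Sig ** transpose V \<and>
     transpose U ** U = mat 1 \<and>
     orthogonal_matrix V \<and>
     (\<forall>i j. i \<noteq> j \<longrightarrow> Sig $ i $ j = 0) \<and> (\<forall>i. 0 \<le> Sig $ i $ i)"

text \<open>The square root is the (in general nonsymmetric) factor \<open>U\<^sup>T A\<close> of the Hessian,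
  not the symmetric positive definite square root.\<close>

definition hess_sqrt :: "real^'d^'n \<Rightarrow> real^'d^'n \<Rightarrow> real^'d^'d" where
  "hess_sqrt A U = transpose U ** A"

definition Delta :: "real^'d^'n \<Rightarrow> real^'d \<Rightarrow> real^'d^'n \<Rightarrow> real^'d \<Rightarrow> real^'d" where
  "Delta A b U x = hess_sqrt A U *v (x - minimizer A b)"

definition delta :: "real^'d^'n \<Rightarrow> real^'d \<Rightarrow> real^'d^'n \<Rightarrow> real^'d \<Rightarrow> real" where
  "delta A b U x = 1/2 * (norm (Delta A b U x))\<^sup>2"

section \<open>Sketching\<close>

definition sketched_hess :: "real^'d^'n \<Rightarrow> real^'n^'m \<Rightarrow> real^'d^'d" where
  "sketched_hess A S = transpose A ** transpose S ** S ** A"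

definition sketched_gram :: "real^'d^'n \<Rightarrow> real^'n^'m \<Rightarrow> real^'d^'d" where
  "sketched_gram U S = transpose U ** transpose S ** S ** U"

definition outer_product :: "real^'d \<Rightarrow> real^'d \<Rightarrow> real^'d^'d" where
  "outer_product u w = (\<chi> j k. u $ j * w $ k)"

definition eigen_decomposition ::
    "real^'d^'d \<Rightarrow> ('d \<Rightarrow> real) \<Rightarrow> ('d \<Rightarrow> real^'d) \<Rightarrow> bool" where
  "eigen_decomposition C lam v \<longleftrightarrow>
     (\<forall>i j. v i \<bullet> v j = (if i = j then 1 else 0)) \<and>
     C = (\<Sum>i\<in>UNIV. lam i *\<^sub>R outer_product (v i) (v i))"

section \<open>The optimal value\<close>

definition residual_polys :: "nat \<Rightarrow> real poly set" where
  "residual_polys t = {Q. degree Q \<le> t \<and> poly Q 0 = 1}"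

definition residual_value :: "('d::finite \<Rightarrow> real) \<Rightarrow> ('d \<Rightarrow> real) \<Rightarrow> real poly \<Rightarrow> real" where
  "residual_value lam xi Q = 1/2 * (\<Sum>i\<in>UNIV. (poly Q (inverse (lam i)))\<^sup>2 * (xi i)\<^sup>2)"

text \<open>The set of values is nonempty and bounded below by \<open>0\<close>, so the infimum is genuine.
  That it is a minimum is a separate claim.\<close>

definition ell_star :: "('d::finite \<Rightarrow> real) \<Rightarrow> ('d \<Rightarrow> real) \<Rightarrow> nat \<Rightarrow> real" where
  "ell_star lam xi t = (INF Q\<in>residual_polys t. residual_value lam xi Q)"

section \<open>The methods\<close>

definition precond_first_order_method ::
    "real^'d^'n \<Rightarrow> real^'d \<Rightarrow> real^'n^'m \<Rightarrow> real^'d \<Rightarrow> (nat \<Rightarrow> real^'d) \<Rightarrow> bool" where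
  "precond_first_order_method A b S x0 x \<longleftrightarrow>
     x 0 = x0 \<and>
     (\<forall>t. x (Suc t) \<in> (+) x0 `
        span ((\<lambda>s. matrix_inv (sketched_hess A S) *v gradient (objective A b) (x s)) ` {..t}))"

text \<open>Conjugate gradients for \<open>H x = b\<close> with preconditioner \<open>P\<close>. The state is the triple of
  iterate, residual and search direction; it is frozen once the residual vanishes.\<close>

definition pcg_step ::
    "real^'d^'d \<Rightarrow> real^'d^'d \<Rightarrow> (real^'d) \<times> (real^'d) \<times> (real^'d)
      \<Rightarrow> (real^'d) \<times> (real^'d) \<times> (real^'d)" where
  "pcg_step H P = (\<lambda>(x, r, p).
     if r = 0 then (x, r, p)
     else
       let rh = matrix_inv P *v r;
           \<alpha> = (r \<bullet> rh) / (p \<bullet> (H *v p));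
           x' = x + \<alpha> *\<^sub>R p;
           r' = r - \<alpha> *\<^sub>R (H *v p);
           rh' = matrix_inv P *v r';
           p' = rh' + ((r' \<bullet> rh') / (r \<bullet> rh)) *\<^sub>R p
       in (x', r', p'))"

primrec pcg_state ::
    "real^'d^'d \<Rightarrow> real^'d^'d \<Rightarrow> real^'d \<Rightarrow> real^'d \<Rightarrow> nat
      \<Rightarrow> (real^'d) \<times> (real^'d) \<times> (real^'d)" where
  "pcg_state H P b x0 0 = (x0, b - H *v x0, matrix_inv P *v (b - H *v x0))"
| "pcg_state H P b x0 (Suc t) = pcg_step H P (pcg_state H P b x0 t)"

definition pcg_iterate ::
    "real^'d^'d \<Rightarrow> real^'d^'d \<Rightarrow> real^'d \<Rightarrow> real^'d \<Rightarrow> nat \<Rightarrow> real^'d" where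
  "pcg_iterate H P b x0 t = fst (pcg_state H P b x0 t)"

section \<open>Agreement with the closed forms\<close>

lemma inner_hess: "x \<bullet> (hess A *v y) = (A *v x) \<bullet> (A *v y)"
  for A :: "real^'d^'n"
proof -
  have "hess A *v y = (A *v y) v* A"
    by (simp add: hess_def transpose_matrix_vector flip: matrix_vector_mul_assoc)
  then show ?thesis
    by (metis dot_lmul_matrix inner_commute)
qed

lemma gderiv_objective: "GDERIV (objective A b) x :> hess A *v x - b"
  for A :: "real^'d^'n"
proof -
  have sym: "h \<bullet> (hess A *v x) = x \<bullet> (hess A *v h)" for h
    by (simp add: inner_hess inner_commute)
  have "(objective A b has_derivative
      (\<lambda>h. 1/2 * (x \<bullet> (hess A *v h) + h \<bullet> (hess A *v x)) - b \<bullet> h)) (at x)"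
    unfolding objective_def
    by (intro has_derivative_diff has_derivative_mult_right has_derivative_inner
        has_derivative_ident has_derivative_inner_right
        bounded_linear.has_derivative[OF matrix_vector_mul_bounded_linear])
  moreover have "(\<lambda>h. 1/2 * (x \<bullet> (hess A *v h) + h \<bullet> (hess A *v x)) - b \<bullet> h)
      = (\<lambda>h. h \<bullet> (hess A *v x - b))"
    by (rule ext) (simp add: sym inner_diff_right inner_commute)
  ultimately show ?thesis
    unfolding gderiv_def by simp
qed

lemma gradient_eqI:
  assumes "GDERIV f x :> D"
  shows "gradient f x = D"
  unfolding gradient_def
proof (rule the_equality)
  fix E assume "GDERIV f x :> E"
  then have "(\<lambda>h. h \<bullet> E) = (\<lambda>h. h \<bullet> D)"
    using assms unfolding gderiv_def by (rule has_derivative_unique)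
  then show "E = D"
    by (metis vector_eq_rdot inner_commute)
qed (fact assms)

lemma gradient_objective: "gradient (objective A b) x = hess A *v x - b"
  by (rule gradient_eqI) (rule gderiv_objective)

context
  fixes A :: "real^'d^'n" and b :: "real^'d"
  assumes full: "rank A = CARD('d)"
begin

lemma invertible_hess: "invertible (hess A)"
proof -
  have "x = 0" if "hess A *v x = 0" for x
  proof -
    have "(A *v x) \<bullet> (A *v x) = 0"
      using that by (simp flip: inner_hess)
    then have "A *v x = A *v 0" by simp
    then show "x = 0"
      using full unfolding full_rank_injective by (rule injD[rotated])
  qed
  then show ?thesis
    unfolding invertible_left_inverse by (subst matrix_left_invertible_ker) blast
qed

lemma objective_expand:
  "objective A b y = objective A b (matrix_inv (hess A) *v b)
     + 1/2 * (norm (A *v (y - matrix_inv (hess A) *v b)))\<^sup>2"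
proof -
  define z where "z = matrix_inv (hess A) *v b"
  have "hess A *v z = b"
    using someI_ex[OF invertible_hess[unfolded invertible_def]]
    by (simp add: z_def matrix_vector_mul_assoc matrix_inv_def)
  then have b: "b \<bullet> w = (A *v z) \<bullet> (A *v w)" for w
    by (metis inner_hess inner_commute)
  show ?thesis
    unfolding z_def[symmetric] objective_def inner_hess b power2_norm_eq_inner
      matrix_vector_mult_diff_distrib
    by (simp add: algebra_simps inner_commute)
qed

lemma minimizer_is_arg_min: "is_arg_min (objective A b) (\<lambda>_. True) (matrix_inv (hess A) *v b)"
  unfolding is_arg_min_linorder
  by (metis objective_expand le_add_same_cancel1 zero_le_power2 mult_nonneg_nonneg
      zero_le_divide_1_iff zero_le_numeral)

lemma minimizer_eq: "minimizer A b = matrix_inv (hess A) *v b"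
proof -
  let ?z = "matrix_inv (hess A) *v b"
  have "is_arg_min (objective A b) (\<lambda>_. True) (minimizer A b)"
    unfolding minimizer_def arg_min_def using minimizer_is_arg_min by (rule someI)
  then have "objective A b (minimizer A b) \<le> objective A b ?z"
    by (simp add: is_arg_min_linorder)
  then have "norm (A *v (minimizer A b - ?z)) = 0"
    unfolding objective_expand[of "minimizer A b"] by simp
  then have "A *v (minimizer A b - ?z) = A *v 0" by simp
  then have "minimizer A b - ?z = 0"
    using full unfolding full_rank_injective by (rule injD[rotated])
  then show ?thesis by simp
qed

end

end

theory Submission
  imports Defs
begin

text \<open>Every admissible iterate lies in \<open>x0 + K\<^sub>t\<close>, where \<open>K\<^sub>t\<close> is the Krylov space of
  \<open>H\<^sub>S\<^sup>-\<^sup>1 H\<close> generated by the preconditioned initial residual. The map \<open>H\<^sup>1\<^sup>/\<^sup>2\<close> conjugates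
  \<open>H\<^sub>S\<^sup>-\<^sup>1 H\<close> to \<open>C\<^sub>S\<^sup>-\<^sup>1\<close>, so in the basis \<open>v\<close> the errors of the points of \<open>x0 + K\<^sub>t\<close> are exactly
  the vectors with coordinates \<open>Q(1/\<lambda>\<^sub>i) \<xi>\<^sub>i\<close>, with \<open>Q\<close> of degree at most \<open>t\<close> and \<open>Q(0) = 1\<close>; this
  gives the lower bound. The PCG residual is orthogonal to \<open>K\<^sub>t\<close>, which says that the PCG
  iterate minimizes the energy error over \<open>x0 + K\<^sub>t\<close>.\<close>

section \<open>Krylov spaces\<close>

text \<open>The index counts generators: exponents stay strictly below \<open>t\<close>, so index
  \<open>0\<close> gives the zero space, matching an iterate that has not left
  \<open>x0\<close>.\<close>

definition krylov :: "('a::real_vector \<Rightarrow> 'a) \<Rightarrow> 'a \<Rightarrow> nat \<Rightarrow> 'a set" where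
  "krylov f g t = span ((\<lambda>j. (f ^^ j) g) ` {..<t})"

lemma subspace_krylov: "subspace (krylov f g t)"
  unfolding krylov_def by (rule subspace_span)

lemma krylov_mono: "s \<le> t \<Longrightarrow> krylov f g s \<subseteq> krylov f g t"
  unfolding krylov_def by (intro span_mono image_mono) auto

lemma krylov_0: "krylov f g 0 = {0}"
  by (simp add: krylov_def)

lemma krylov_Suc: "krylov f g (Suc t) = span (insert ((f ^^ t) g) ((\<lambda>j. (f ^^ j) g) ` {..<t}))"
  by (simp add: krylov_def lessThan_Suc)

lemma funpow_in_krylov: "j < t \<Longrightarrow> (f ^^ j) g \<in> krylov f g t"
  unfolding krylov_def by (intro span_base) auto

lemma generator_in_krylov: "g \<in> krylov f g (Suc t)"
  using funpow_in_krylov[of 0 "Suc t" f g] by simp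

lemma krylov_map:
  assumes "linear f" "x \<in> krylov f g t"
  shows "f x \<in> krylov f g (Suc t)"
proof -
  have "f x \<in> span (f ` (\<lambda>j. (f ^^ j) g) ` {..<t})"
    using assms by (simp add: krylov_def linear_span_image)
  moreover have "f ` (\<lambda>j. (f ^^ j) g) ` {..<t} \<subseteq> (\<lambda>j. (f ^^ j) g) ` {..<Suc t}"
  proof clarsimp
    fix j assume "j < t"
    then show "f ((f ^^ j) g) \<in> (\<lambda>j. (f ^^ j) g) ` {..<Suc t}"
      by (intro image_eqI[of _ _ "Suc j"]) auto
  qed
  ultimately show ?thesis
    unfolding krylov_def using span_mono by blast
qed

text \<open>Steinitz exchange: one step adds at most one dimension, so any new vector
  \<open>p\<close> can replace the last power as the extra generator.\<close>

lemma krylov_Suc_exchange: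
  assumes "p \<in> krylov f g (Suc t)" "p \<notin> krylov f g t" "k \<in> krylov f g (Suc t)"
  obtains c k' where "k' \<in> krylov f g t" "k = c *\<^sub>R p + k'"
proof -
  let ?B = "(\<lambda>j. (f ^^ j) g) ` {..<t}"
  have gen: "(f ^^ t) g \<in> span (insert p ?B)"
    using assms(1,2) in_span_insert unfolding krylov_Suc unfolding krylov_def by blast
  have "span (insert ((f ^^ t) g) ?B) \<subseteq> span (insert p ?B)"
    using gen by (intro span_minimal) (auto intro: span_base)
  then have "k \<in> span (insert p ?B)"
    using assms(3) by (auto simp: krylov_Suc)
  then obtain c where "k - c *\<^sub>R p \<in> span ?B"
    using span_breakdown_eq by blast
  then show ?thesis
    by (intro that[of "k - c *\<^sub>R p" c]) (auto simp: krylov_def)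
qed

text \<open>Bounding the degree of \<open>pCons 0 q\<close> avoids a case distinction for \<open>t = 0\<close>, where only \<open>q = 0\<close> is allowed.\<close>

lemma krylov_imp_poly:
  fixes c :: "'i \<Rightarrow> 'a::real_vector \<Rightarrow> real"
  assumes c: "\<And>i. linear (c i)" and eig: "\<And>i x. c i (f x) = \<mu> i * c i x"
    and k: "k \<in> krylov f g t"
  shows "\<exists>q. degree (pCons 0 q) \<le> t \<and> (\<forall>i. c i k = poly q (\<mu> i) * c i g)"
proof -
  have pow: "c i ((f ^^ j) g) = \<mu> i ^ j * c i g" for i j
    by (induction j) (auto simp: eig)
  have "k \<in> span ((\<lambda>j. (f ^^ j) g) ` {..<t})"
    using k by (simp add: krylov_def)
  then show ?thesis
  proof (induction rule: span_induct_alt)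
    case base
    show ?case using c by (intro exI[of _ 0]) (auto simp: linear_0)
  next
    case (step a x y)
    then obtain q where q: "degree (pCons 0 q) \<le> t" "\<And>i. c i y = poly q (\<mu> i) * c i g"
      by blast
    obtain j where j: "j < t" "x = (f ^^ j) g" using step by auto
    have "degree (pCons 0 (monom a j)) \<le> t"
      using j degree_monom_le[of a j] degree_pCons_le[of 0 "monom a j"] by linarith
    then have "degree (pCons 0 (monom a j) + pCons 0 q) \<le> t"
      using q by (intro degree_add_le)
    then have "degree (pCons 0 (monom a j + q)) \<le> t" by simp
    moreover have "c i (a *\<^sub>R x + y) = poly (monom a j + q) (\<mu> i) * c i g" for i
      by (simp add: linear_add[OF c] linear_scale[OF c] j pow q poly_monom algebra_simps)
    ultimately show ?case by blast
  qed
qed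

lemma poly_imp_krylov:
  fixes c :: "'i \<Rightarrow> 'a::real_vector \<Rightarrow> real"
  assumes c: "\<And>i. linear (c i)" and eig: "\<And>i x. c i (f x) = \<mu> i * c i x"
    and q: "degree (pCons 0 q) \<le> t"
  shows "\<exists>k\<in>krylov f g t. \<forall>i. c i k = poly q (\<mu> i) * c i g"
proof
  have pow: "c i ((f ^^ j) g) = \<mu> i ^ j * c i g" for i j
    by (induction j) (auto simp: eig)
  let ?k = "\<Sum>j\<le>degree q. coeff q j *\<^sub>R (f ^^ j) g"
  show "\<forall>i. c i ?k = poly q (\<mu> i) * c i g"
    by (simp add: linear_sum[OF c] linear_scale[OF c] pow poly_altdef sum_distrib_right mult.assoc)
  show "?k \<in> krylov f g t"
  \<comment> \<open>For \<open>q = 0\<close> the sum still has the term \<open>j = 0\<close>, which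
    need not be a generator when \<open>t = 0\<close>; it vanishes with its coefficient. Otherwise
    \<open>pCons 0 q\<close> has degree \<open>degree q + 1\<close>, so all exponents lie below
    \<open>t\<close>.\<close>
  proof (cases "q = 0")
    case True
    then show ?thesis using subspace_0[OF subspace_krylov] by simp
  next
    case False
    then show ?thesis
      using q by (intro subspace_sum subspace_scale subspace_krylov funpow_in_krylov) auto
  qed
qed

section \<open>Conjugate gradients\<close>

text \<open>Conjugacy of \<open>p\<close> to all of \<open>K t\<close> replaces the usual conjugacy
  to each earlier direction, so the short recurrence only has to treat the newest direction. The
  guard \<open>r \<noteq> 0\<close> lets a frozen state pass to the next space with the residual
  clauses alone.\<close>

lemma pcg_state_invariant:
  fixes H P :: "real^'d^'d" and b x0 :: "real^'d"
  defines "N \<equiv> matrix_inv P"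
  defines "K \<equiv> krylov (\<lambda>x. N *v (H *v x)) (N *v (b - H *v x0))"
  assumes symH: "\<And>x y. x \<bullet> (H *v y) = (H *v x) \<bullet> y"
    and posH: "\<And>x. x \<noteq> 0 \<Longrightarrow> x \<bullet> (H *v x) > 0"
    and symN: "\<And>x y. x \<bullet> (N *v y) = (N *v x) \<bullet> y"
    and posN: "\<And>x. x \<noteq> 0 \<Longrightarrow> x \<bullet> (N *v x) > 0"
  shows "case pcg_state H P b x0 t of (x, r, p) \<Rightarrow>
    r = b - H *v x \<and> x - x0 \<in> K t \<and> (\<forall>k\<in>K t. r \<bullet> k = 0) \<and>
    (r \<noteq> 0 \<longrightarrow> p - N *v r \<in> K t \<and> (\<forall>k\<in>K t. p \<bullet> (H *v k) = 0))"
proof (induction t)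
  case 0
  show ?case by (simp add: K_def krylov_0 N_def)
next
  case (Suc t)
  have lin: "linear (\<lambda>x. N *v (H *v x))"
    by (intro linearI) (simp_all add: matrix_vector_right_distrib matrix_vector_mult_scaleR)
  have sub: "subspace (K s)" for s
    unfolding K_def by (rule subspace_krylov)
  have mono: "k \<in> K (Suc t)" if "k \<in> K t" for k
    using that krylov_mono[of t "Suc t"] unfolding K_def by auto
  have map: "N *v (H *v k) \<in> K (Suc t)" if "k \<in> K t" for k
    using krylov_map[OF lin] that unfolding K_def by blast
  obtain x r p where st: "pcg_state H P b x0 t = (x, r, p)" by (cases "pcg_state H P b x0 t")
  with Suc have r: "r = b - H *v x" and xK: "x - x0 \<in> K t" and rK: "\<And>k. k \<in> K t \<Longrightarrow> r \<bullet> k = 0"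
    and pz: "r \<noteq> 0 \<Longrightarrow> p - N *v r \<in> K t"
    and pK: "\<And>k. r \<noteq> 0 \<Longrightarrow> k \<in> K t \<Longrightarrow> p \<bullet> (H *v k) = 0"
    by auto
  show ?case
  proof (cases "r = 0")
    case True
    then show ?thesis using st r xK mono by (simp add: pcg_step_def)
  next
    case False
    define z where "z = N *v r"
    define \<alpha> where "\<alpha> = (r \<bullet> z) / (p \<bullet> (H *v p))"
    define x' where "x' = x + \<alpha> *\<^sub>R p"
    define r' where "r' = r - \<alpha> *\<^sub>R (H *v p)"
    define \<beta> where "\<beta> = (r' \<bullet> (N *v r')) / (r \<bullet> z)"
    define p' where "p' = N *v r' + \<beta> *\<^sub>R p"
    have st': "pcg_state H P b x0 (Suc t) = (x', r', p')"
      using st False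
      by (simp add: pcg_step_def Let_def x'_def r'_def p'_def z_def \<alpha>_def \<beta>_def N_def)
    have pzK: "p - z \<in> K t" using pz False by (simp add: z_def)
    have rz: "r \<bullet> z > 0" using posN False by (simp add: z_def)
    have rp: "r \<bullet> p = r \<bullet> z" using rK[OF pzK] by (simp add: inner_diff_right)
    \<comment> \<open>\<open>r\<close> annihilates \<open>K t\<close> but not \<open>p\<close>, so
      \<open>p\<close> is a new direction and the exchange applies.\<close>
    have pnK: "p \<notin> K t" using rK rp rz by force
    have "p \<noteq> 0" using rp rz by auto
    then have pHp: "p \<bullet> (H *v p) > 0" by (rule posH)
    have \<alpha>: "\<alpha> > 0" using rz pHp by (simp add: \<alpha>_def)
    have zK: "z \<in> K (Suc t)"
    proof -
      have "z = N *v (b - H *v x0) - N *v (H *v (x - x0))"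
        by (simp add: z_def r matrix_vector_mult_diff_distrib)
      moreover have "N *v (b - H *v x0) \<in> K (Suc t)"
        unfolding K_def by (rule generator_in_krylov)
      ultimately show ?thesis
        using subspace_diff[OF sub _ map[OF xK]] by simp
    qed
    have pSK: "p \<in> K (Suc t)"
      using subspace_add[OF sub zK mono[OF pzK]] by simp
    have exchange: "\<exists>k'\<in>K t. \<exists>c. k = c *\<^sub>R p + k'" if k: "k \<in> K (Suc t)" for k
      using krylov_Suc_exchange[OF pSK[unfolded K_def] pnK[unfolded K_def] k[unfolded K_def], folded K_def]
      by blast
    \<comment> \<open>On \<open>K t\<close> both \<open>r\<close> and \<open>H *v p\<close> vanish
      by induction; along \<open>p\<close> the choice of \<open>\<alpha>\<close> is exact line
      search, because \<open>r \<bullet> z = r \<bullet> p\<close>.\<close>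
    have r'K: "r' \<bullet> k = 0" if k: "k \<in> K (Suc t)" for k
    proof -
      obtain c k' where k': "k' \<in> K t" "k = c *\<^sub>R p + k'"
        using exchange[OF k] by blast
      have "r' \<bullet> k' = 0"
        using k' rK pK False by (simp add: r'_def inner_diff_left flip: symH)
      moreover have "r' \<bullet> p = 0"
        using pHp rp by (simp add: r'_def inner_diff_left \<alpha>_def flip: symH)
      ultimately show ?thesis by (simp add: k' inner_add_right)
    qed
    have p'K: "p' \<bullet> (H *v k) = 0" if k: "k \<in> K (Suc t)" for k
    proof -
      obtain c k' where k': "k' \<in> K t" "k = c *\<^sub>R p + k'"
        using exchange[OF k] by blast
      \<comment> \<open>Moving \<open>N\<close> across turns this into \<open>r'\<close> tested on
        the image of \<open>k'\<close>, which lies in \<open>K (Suc t)\<close>.\<close>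
      have "(N *v r') \<bullet> (H *v k') = 0"
        using r'K[OF map[OF k'(1)]] by (simp add: symN)
      then have 1: "p' \<bullet> (H *v k') = 0"
        using k' pK False by (simp add: p'_def inner_add_left)
      \<comment> \<open>Orthogonality of \<open>r'\<close> to \<open>z\<close> converts the residual
        quotient \<open>\<beta>\<close> into the quotient that makes \<open>p'\<close> conjugate to
        \<open>p\<close>.\<close>
      have "(N *v r') \<bullet> r = 0"
        using r'K[OF zK] by (simp add: z_def symN)
      then have "(N *v r') \<bullet> r' = - \<alpha> * ((N *v r') \<bullet> (H *v p))"
        unfolding r'_def[THEN arg_cong, of "\<lambda>y. (N *v r') \<bullet> y"]
        by (simp add: inner_diff_right)
      then have "(N *v r') \<bullet> (H *v p) = - (r' \<bullet> (N *v r')) / \<alpha>"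
        using \<alpha> by (simp add: field_simps inner_commute)
      then have "p' \<bullet> (H *v p) = 0"
        using rz pHp by (simp add: p'_def inner_add_left \<alpha>_def \<beta>_def)
      with 1 show ?thesis
        by (simp add: k' matrix_vector_right_distrib matrix_vector_mult_scaleR inner_add_right)
    qed
    have "r' = b - H *v x'"
      by (simp add: r'_def x'_def r matrix_vector_right_distrib matrix_vector_mult_scaleR)
    moreover have "x' - x0 \<in> K (Suc t)"
      using subspace_add[OF sub mono[OF xK] subspace_scale[OF sub pSK, of \<alpha>]]
      by (simp add: x'_def algebra_simps)
    moreover have "p' - N *v r' \<in> K (Suc t)"
      using subspace_scale[OF sub pSK] by (simp add: p'_def)
    ultimately show ?thesis unfolding st' using r'K p'K by simp
  qed
qed

text \<open>A preconditioned gradient is the Krylov map applied to \<open>x s - x0\<close>, minus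
  the generator, so it raises the Krylov index by one. Strong induction is used because the span
  involves all earlier gradients.\<close>

lemma first_order_in_krylov:
  fixes A :: "real^'d^'n" and S :: "real^'n^'m"
  defines "N \<equiv> matrix_inv (sketched_hess A S)"
  assumes "precond_first_order_method A b S x0 x"
  shows "x t - x0 \<in> krylov (\<lambda>y. N *v (hess A *v y)) (N *v (b - hess A *v x0)) t"
proof (induction t rule: less_induct)
  case (less t)
  let ?f = "\<lambda>y. N *v (hess A *v y)" and ?g = "N *v (b - hess A *v x0)"
  have lin: "linear ?f"
    by (intro linearI) (simp_all add: matrix_vector_right_distrib matrix_vector_mult_scaleR)
  show ?case
  proof (cases t)
    case 0
    then show ?thesis using assms by (simp add: precond_first_order_method_def krylov_0)
  next
    case (Suc u)
    have "N *v gradient (objective A b) (x s) \<in> krylov ?f ?g t" if "s \<le> u" for s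
    proof -
      have "x s - x0 \<in> krylov ?f ?g u"
        using less[of s] that Suc krylov_mono[of s u ?f ?g] by auto
      then have "?f (x s - x0) \<in> krylov ?f ?g t"
        using krylov_map[OF lin] Suc by blast
      moreover have "N *v gradient (objective A b) (x s) = ?f (x s - x0) - ?g"
        by (simp add: gradient_objective matrix_vector_mult_diff_distrib)
      ultimately show ?thesis
        using subspace_diff[OF subspace_krylov _ generator_in_krylov] Suc by simp
    qed
    then have "span ((\<lambda>s. N *v gradient (objective A b) (x s)) ` {..u}) \<subseteq> krylov ?f ?g t"
      by (intro span_minimal subspace_krylov) auto
    moreover have "x t \<in> (+) x0 ` span ((\<lambda>s. N *v gradient (objective A b) (x s)) ` {..u})"
      using assms(2) Suc by (simp add: precond_first_order_method_def N_def)
    ultimately show ?thesis by auto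
  qed
qed

section \<open>Orthonormal eigenbases\<close>

text \<open>Parseval: the matrix with rows \<open>v i\<close> is square, so its right inverse, the
  transpose, is also a left inverse.\<close>

lemma norm_sq_orthonormal:
  fixes v :: "'d::finite \<Rightarrow> real^'d"
  assumes "\<And>i j. v i \<bullet> v j = (if i = j then 1 else 0)"
  shows "(norm y)\<^sup>2 = (\<Sum>i\<in>UNIV. (v i \<bullet> y)\<^sup>2)"
proof -
  define R :: "real^'d^'d" where "R = (\<chi> i. v i)"
  have "R ** transpose R = mat 1"
    using assms
    by (simp add: R_def vec_eq_iff matrix_matrix_mult_def transpose_def mat_def inner_vec_def)
  then have "hess R = mat 1"
    by (simp add: hess_def matrix_left_right_inverse)
  then have "(norm (R *v y))\<^sup>2 = (norm y)\<^sup>2"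
    using inner_hess[of y R y] by (simp add: power2_norm_eq_inner)
  moreover have "(norm (R *v y))\<^sup>2 = (\<Sum>i\<in>UNIV. (v i \<bullet> y)\<^sup>2)"
    unfolding power2_norm_eq_inner
    by (simp add: R_def inner_vec_def matrix_vector_mult_def power2_eq_square)
  ultimately show ?thesis by simp
qed

lemma eigen_decomposition_inner:
  fixes C :: "real^'d^'d"
  assumes "eigen_decomposition C lam v"
  shows "v i \<bullet> (C *v y) = lam i * (v i \<bullet> y)"
proof -
  have op: "outer_product (v j) (v j) *v y = (v j \<bullet> y) *\<^sub>R v j" for j
    by (simp add: vec_eq_iff outer_product_def matrix_vector_mult_def inner_vec_def
        sum_distrib_left mult_ac)
  have orth: "v i \<bullet> v j = (if i = j then 1 else 0)" for j
    using assms by (simp add: eigen_decomposition_def)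
  have lin: "linear (\<lambda>M :: real^'d^'d. M *v y)"
    by (intro linearI) (simp_all add: matrix_vector_mult_add_rdistrib scaleR_matrix_vector_assoc)
  have "C *v y = (\<Sum>j\<in>UNIV. (lam j *\<^sub>R outer_product (v j) (v j)) *v y)"
    using assms linear_sum[OF lin] by (simp add: eigen_decomposition_def)
  also have "\<dots> = (\<Sum>j\<in>UNIV. (lam j * (v j \<bullet> y)) *\<^sub>R v j)"
    by (simp add: op flip: scaleR_matrix_vector_assoc)
  finally show ?thesis
    by (simp add: inner_sum_right orth if_distrib sum.delta cong: if_cong)
qed

text \<open>Both properties pass from \<open>P\<close> to \<open>N\<close> by writing each vector as
  \<open>P *v (N *v z)\<close>.\<close>

lemma pos_def_inverse:
  fixes P :: "real^'d^'d"
  assumes inv: "P ** N = mat 1"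
    and sym: "\<And>x y. x \<bullet> (P *v y) = (P *v x) \<bullet> y"
    and pos: "\<And>x. x \<noteq> 0 \<Longrightarrow> x \<bullet> (P *v x) > 0"
  shows "x \<bullet> (N *v y) = (N *v x) \<bullet> y" and "x \<noteq> 0 \<Longrightarrow> x \<bullet> (N *v x) > 0"
proof -
  have PN: "P *v (N *v z) = z" for z
    using inv by (simp add: matrix_vector_mul_assoc)
  show "x \<bullet> (N *v y) = (N *v x) \<bullet> y"
    using sym[of "N *v x" "N *v y"] by (simp add: PN)
  assume "x \<noteq> 0"
  then have "N *v x \<noteq> 0" using PN[of x] by (metis matrix_vector_mult_0_right)
  then show "x \<bullet> (N *v x) > 0"
    using pos[of "N *v x"] by (simp add: PN inner_commute)
qed

theorem theorem3p1:
  fixes A :: "real^'d^'n" and b :: "real^'d"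
    and U :: "real^'d^'n" and Sig V :: "real^'d^'d"
    and S :: "real^'n^'m"
    and lam xi :: "'d \<Rightarrow> real" and v :: "'d \<Rightarrow> real^'d"
    and x0 :: "real^'d"
  assumes "CARD('n) \<ge> CARD('d)"
    and "rank A = CARD('d)"
    and "thin_svd A U Sig V"
    and "rank (S ** A) = CARD('d)"
    and "eigen_decomposition (sketched_gram U S) lam v"
    and "\<And>i. xi i = v i \<bullet> Delta A b U x0"
  shows "(\<forall>t. \<exists>Q\<in>residual_polys t. residual_value lam xi Q = ell_star lam xi t) \<and>
    (\<forall>x. precond_first_order_method A b S x0 x \<longrightarrow>
       (\<forall>t. delta A b U (x t) \<ge> ell_star lam xi t)) \<and>
    (\<forall>t. delta A b U (pcg_iterate (hess A) (sketched_hess A S) b x0 t) = ell_star lam xi t)"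
proof -
  define H where "H = hess A"
  define P where "P = sketched_hess A S"
  define N where "N = matrix_inv P"
  define W where "W = hess_sqrt A U"
  define C where "C = sketched_gram U S"
  define xs where "xs = minimizer A b"
  define f where "f = (\<lambda>x. N *v (H *v x))"
  define g where "g = N *v (b - H *v x0)"
  define K where "K = krylov f g"
  define c where "c = (\<lambda>i x. v i \<bullet> (W *v x))"
  define \<mu> where "\<mu> = (\<lambda>i. inverse (lam i))"
  define y where "y = pcg_iterate H P b x0"

  \<comment> \<open>Factorization of \<open>H\<close> and \<open>P\<close> through
    \<open>W\<close>\<close>
  have UU: "transpose U ** U = mat 1" and Asvd: "A = U ** Sig ** transpose V"
    using assms(3) by (auto simp: thin_svd_def)
  \<comment> \<open>\<open>U ** transpose U\<close> is in general only a projection; it fixes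
    \<open>A\<close> because the SVD places the columns of \<open>A\<close> in the range of
    \<open>U\<close>.\<close>
  have "W = Sig ** transpose V"
    by (metis (no_types) W_def hess_sqrt_def Asvd UU matrix_mul_assoc matrix_mul_lid)
  then have AUW: "A = U ** W"
    using Asvd by (simp add: matrix_mul_assoc)
  have HW: "H = transpose W ** W"
    by (metis (no_types) H_def hess_def AUW matrix_transpose_mul matrix_mul_assoc UU matrix_mul_lid)
  have PW: "P = transpose W ** (C ** W)"
    unfolding P_def C_def sketched_hess_def sketched_gram_def AUW
    by (simp add: matrix_transpose_mul matrix_mul_assoc)
  have P_hess: "P = hess (S ** A)"
    by (simp add: P_def hess_def sketched_hess_def matrix_transpose_mul matrix_mul_assoc)
  have invP: "invertible P" and invH: "invertible H"
    using invertible_hess assms by (auto simp: P_hess H_def)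
  have PN: "P ** N = mat 1"
    using someI_ex[OF invP[unfolded invertible_def]] by (simp add: N_def matrix_inv_def)
  have inner_H: "x \<bullet> (H *v z) = (W *v x) \<bullet> (W *v z)" for x z
    using inner_hess[of x W z] by (simp add: HW hess_def)
  have invW: "invertible W"
    by (metis HW invH invertible_left_inverse matrix_mul_assoc invertible_def)
  have posdef: "x \<bullet> (hess B *v x) > 0" if "invertible (hess B)" "x \<noteq> 0"
    for B :: "real^'d^'k" and x
  proof -
    have "B *v x \<noteq> 0"
      using that unfolding invertible_left_inverse matrix_left_invertible_ker hess_def
      by (metis matrix_vector_mul_assoc matrix_vector_mult_0_right)
    then show ?thesis by (simp add: inner_hess)
  qed
  have symH: "x \<bullet> (H *v z) = (H *v x) \<bullet> z" for x z
    by (metis H_def inner_hess inner_commute)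
  have symP: "x \<bullet> (P *v z) = (P *v x) \<bullet> z" for x z
    by (metis P_hess inner_hess inner_commute)
  have posH: "x \<noteq> 0 \<Longrightarrow> x \<bullet> (H *v x) > 0" and posP: "x \<noteq> 0 \<Longrightarrow> x \<bullet> (P *v x) > 0" for x
    using posdef invH invP by (auto simp: H_def P_hess)
  note N = pos_def_inverse[OF PN symP posP]
  have Hxs: "H *v xs = b"
    using someI_ex[OF invH[unfolded invertible_def]] minimizer_eq[OF assms(2)]
    by (simp add: xs_def H_def matrix_vector_mul_assoc matrix_inv_def)

  \<comment> \<open>Diagonalization of the Krylov map in the eigenbasis\<close>
  have orth: "v i \<bullet> v j = (if i = j then 1 else 0)" for i j
    using assms(5) by (simp add: eigen_decomposition_def)
  have Cv: "v i \<bullet> (C *v z) = lam i * (v i \<bullet> z)" for i z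
    using eigen_decomposition_inner assms(5) C_def by blast
  \<comment> \<open>This is the conjugation of \<open>f\<close> to the inverse of \<open>C\<close>,
    written without that inverse, since \<open>lam i \<noteq> 0\<close> is deduced from it
    below.\<close>
  have CWf: "C *v (W *v f x) = W *v x" for x
  proof -
    have "transpose W *v (C *v (W *v f x)) = P *v f x"
      by (simp add: PW matrix_vector_mul_assoc)
    also have "\<dots> = (P ** N) *v (H *v x)"
      by (simp add: f_def flip: matrix_vector_mul_assoc)
    also have "\<dots> = transpose W *v (W *v x)"
      by (simp add: PN HW matrix_vector_mul_assoc)
    finally show ?thesis
      using invW by (metis transpose_invertible inj_matrix_vector_mult injD)
  qed
  have lamf: "lam i * c i (f x) = c i x" for i x
    using Cv[of i "W *v f x"] by (simp add: c_def CWf)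
  \<comment> \<open>As \<open>W\<close> is onto, some vector has \<open>i\<close>-th coordinate 1,
    and a zero eigenvalue would force that coordinate to vanish. Hence
    \<open>inverse (lam i)\<close> is never the default value at zero.\<close>
  have lam: "lam i \<noteq> 0" for i
  proof
    assume 0: "lam i = 0"
    obtain W' where "W ** W' = mat 1" using invW by (auto simp: invertible_def)
    then have "c i (W' *v v i) = 1" by (simp add: c_def matrix_vector_mul_assoc orth)
    then show False using lamf[of i "W' *v v i"] 0 by simp
  qed
  have eig: "c i (f x) = \<mu> i * c i x" for i x
    using lamf[of i x] lam[of i] by (simp add: \<mu>_def field_simps)
  have linc: "linear (c i)" for i
    unfolding c_def by (intro linearI) (simp_all add: matrix_vector_right_distrib
        matrix_vector_mult_scaleR inner_add_right)
  have xi: "xi i = c i (x0 - xs)" for i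
    by (simp add: assms(6) Delta_def c_def W_def xs_def)
  have "g = - f (x0 - xs)"
    by (simp add: g_def f_def matrix_vector_mult_diff_distrib Hxs)
  then have cg: "c i g = - \<mu> i * xi i" for i
    by (simp add: linear_neg[OF linc] eig xi)

  \<comment> \<open>Krylov points and residual polynomials\<close>
  have delta_W: "delta A b U x = 1/2 * (norm (W *v (x - xs)))\<^sup>2" for x
    by (simp add: delta_def Delta_def W_def xs_def)
  \<comment> \<open>The minus sign in \<open>cg\<close> turns a step with polynomial
    \<open>q\<close> into the error polynomial \<open>1 - X q\<close>, which is
    \<open>pCons 1 (- q)\<close>.\<close>
  have delta_val: "delta A b U x = residual_value lam xi (pCons 1 (- q))"
    if "\<And>i. c i (x - x0) = poly q (\<mu> i) * c i g" for x q
  proof -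
    have "c i (x - xs) = poly (pCons 1 (- q)) (\<mu> i) * xi i" for i
    proof -
      have "c i (x - xs) = c i (x - x0) + c i (x0 - xs)"
        by (simp flip: linear_add[OF linc])
      then show ?thesis by (simp add: that cg algebra_simps flip: xi)
    qed
    then show ?thesis
      by (simp add: delta_W norm_sq_orthonormal[OF orth] residual_value_def power_mult_distrib
          flip: c_def[THEN fun_cong, THEN fun_cong] \<mu>_def[THEN fun_cong])
  qed
  have to_poly: "\<exists>Q\<in>residual_polys t. residual_value lam xi Q = delta A b U x"
    if x: "x - x0 \<in> K t" for x t
  proof -
    obtain q where q: "degree (pCons 0 q) \<le> t" "\<And>i. c i (x - x0) = poly q (\<mu> i) * c i g"
      using krylov_imp_poly[where c = c, OF linc eig x[unfolded K_def]] by blast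
    have "pCons 1 (- q) \<in> residual_polys t"
      using q(1) by (cases "q = 0") (auto simp: residual_polys_def)
    then show ?thesis using delta_val[OF q(2)] by metis
  qed
  \<comment> \<open>This direction realizes each competing polynomial by an actual point of
    \<open>x0 + K t\<close>, which can then be compared with the PCG iterate.\<close>
  have of_poly: "\<exists>x. x - x0 \<in> K t \<and> residual_value lam xi Q = delta A b U x"
    if "Q \<in> residual_polys t" for Q t
  proof -
    obtain a q where Q: "Q = pCons a q" by (cases Q)
    have a: "a = 1" and "degree (pCons 0 (- q)) \<le> t"
      using that Q by (auto simp: residual_polys_def split: if_splits)
    then obtain k where k: "k \<in> K t" "\<And>i. c i k = poly (- q) (\<mu> i) * c i g"
      using poly_imp_krylov[where c = c, OF linc eig, of "- q" t] unfolding K_def by blast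
    then show ?thesis
      using delta_val[of "x0 + k" "- q"] by (intro exI[of _ "x0 + k"]) (simp add: Q a)
  qed

  \<comment> \<open>Optimality of the PCG iterate\<close>
  have pcg: "y t - x0 \<in> K t" "\<And>k. k \<in> K t \<Longrightarrow> (b - H *v y t) \<bullet> k = 0" for t
    using pcg_state_invariant[of H P b x0 t, folded N_def, OF symH posH N]
    by (auto simp: y_def pcg_iterate_def K_def f_def g_def split: prod.splits)
  \<comment> \<open>The residual is \<open>H\<close> applied to the negated error, so its
    orthogonality to \<open>K t\<close> is orthogonality of the error in the energy inner product,
    and Pythagoras applies.\<close>
  have pcg_min: "delta A b U (y t) \<le> delta A b U x" if "x - x0 \<in> K t" for x t
  proof -
    let ?k = "x - y t"
    have "?k \<in> K t"
      using subspace_diff[OF _ that pcg(1)] subspace_krylov by (auto simp: K_def)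
    then have "(H *v (y t - xs)) \<bullet> ?k = 0"
      using pcg(2)[of ?k] by (simp add: matrix_vector_mult_diff_distrib Hxs inner_diff_left)
    then have "(W *v (y t - xs)) \<bullet> (W *v ?k) = 0"
      by (simp add: symH flip: inner_H)
    then have "(norm (W *v (y t - xs) + W *v ?k))\<^sup>2
        = (norm (W *v (y t - xs)))\<^sup>2 + (norm (W *v ?k))\<^sup>2"
      by (intro norm_add_Pythagorean) (simp add: orthogonal_def)
    moreover have "W *v (y t - xs) + W *v ?k = W *v (x - xs)"
      by (simp flip: matrix_vector_right_distrib)
    ultimately show ?thesis by (simp add: delta_W)
  qed
  \<comment> \<open>The PCG error is itself a value of an admissible polynomial and bounds all such
    values from below, so the infimum is attained.\<close>
  have ell: "ell_star lam xi t = delta A b U (y t)" for t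
    unfolding ell_star_def
  proof (rule cInf_eq_minimum)
    show "delta A b U (y t) \<in> residual_value lam xi ` residual_polys t"
      using to_poly[OF pcg(1)] by (metis imageI)
    show "delta A b U (y t) \<le> z" if "z \<in> residual_value lam xi ` residual_polys t" for z
      using that of_poly pcg_min by force
  qed
  have "\<exists>Q\<in>residual_polys t. residual_value lam xi Q = ell_star lam xi t" for t
    using to_poly[OF pcg(1)] ell by simp
  moreover have "delta A b U (x t) \<ge> ell_star lam xi t"
    if "precond_first_order_method A b S x0 x" for x t
    using pcg_min first_order_in_krylov[OF that]
    by (simp add: ell K_def f_def g_def N_def P_def H_def)
  moreover have "delta A b U (pcg_iterate (hess A) (sketched_hess A S) b x0 t) = ell_star lam xi t" for t
    by (simp add: ell y_def H_def P_def)
  ultimately show ?thesis by blast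
qed

end
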